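(* Every finite, bounded planar shape $\mathrm{sh}A$ covered by a simplicial complex has a signature $\mathrm{sig}(\mathrm{sh}A)$ derived from the homology group on the complex.
   Context: A finite, bounded planar shape $\mathrm{sh}A$ is a finite region of the Euclidean plane bounded by a simple closed curve and with a nonempty interior. Let $K$ be a simplicial complex covering $\mathrm{sh}A$, with chain groups $C_p(K)$ (coefficients modulo 2) and boundary homomorphisms $\partial_p$. Put $Z_1=\ker\partial_1$ (cycles), $B_1=\mathrm{img}\,\partial_2$ (boundaries) and $H_1=Z_1/B_1$. A 1-cycle $\mathrm{cyc}A$ is a simple, closed, connected path of 1-simplexes (edges, possibly curved arcs) in $K$ that is not a boundary of a hole. $\mathcal{H}_1$ denotes the collection of 1-cycles in the homology groups $H_1$ on $K$. A description $\Phi$ assigns to each arc $x$ a feature vector $\Phi(x)\in\mathbb{R}^n$ (e.g. recording its uniform iso-curvature), and $\Phi(S)=\{\Phi(x):x\in S\}$ for a set $S$. The relator on $\mathcal{H}_1$ consists of two relations. Nonempty sets are strongly near if they have at least one element in common. They are descriptively near, $S\,\delta_\Phi\,T$, if $\Phi(x)=\Phi(y)$ for some $x\in S$, $y\in T$. The descriptive intersection is $S\cap_\Phi T=\{x\in S\cup T:\Phi(x)\in\Phi(S)\text{ and }\Phi(x)\in\Phi(T)\}$. A descriptive homology nerve is a collection of 1-cycles in $\mathcal{H}_1$ with nonempty descriptive intersection. A nucleus of it is a member $\mathrm{cyc}A$ that serves as a representative, in that $\mathrm{cyc}A$ defines a cluster containing all 1-cycles $\mathrm{cyc}B$ with $\mathrm{cyc}A\,\delta_\Phi\,\mathrm{cyc}B$.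 A signature $\mathrm{sig}(\mathrm{sh}A)$ of $\mathrm{sh}A$ is a feature vector that includes at least one of the following components: 1. (Geometry) one or more features of the curvature of each 1-cycle in $\mathcal{H}_1$; 2. (Homology) the rank (Betti number) $rH_1=rZ_1-rB_1$ of the homology group $H_1$; 3. (Homology nerve) the description $\Phi(x)$ of a component $x$ of a 1-cycle $\mathrm{cyc}A\in\mathcal{H}_1$ (the nucleus of a descriptive homology nerve) whose description matches the description of the same component in the other members of that nerve; 4. (Closure finiteness) for arcs whose closure meets only finitely many other arcs in $\mathcal{H}_1$, the description of the closure of such an arc lying in $\mathrm{cyc}A\cap_\Phi\mathrm{cyc}B$ for a finite number of 1-cycles, or the description $\Phi(\mathrm{cyc}A)$ for a selected number of 1-cycles; 5. (Descriptive CW) assuming closure finiteness holds, and with a 1-cycle $\mathrm{cyc}A$ being closed in $\mathcal{H}_1$ provided its nonempty intersections with arcs are closed in $H_1$, the descriptions of arcs that are common to overlapping 1-cycles. *)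

theory Defs
  imports "HOL-Analysis.Analysis" "HOL-Algebra.Coset" "HOL-Algebra.Generated_Groups"
begin

section \<open>Shapes and complexes in the plane\<close>

definition planar_shape :: "(real^2) set \<Rightarrow> bool" where
  "planar_shape A \<longleftrightarrow> bounded A \<and> interior A \<noteq> {} \<and>
     (\<exists>c. simple_path c \<and> pathfinish c = pathstart c \<and> frontier A = path_image c)"

text \<open>A complex in the plane whose simplexes may be curved is a straight simplicial complex \<open>L\<close>
  together with an embedding \<open>h\<close> of its polyhedron into the plane.  The ambient space of \<open>L\<close> is
  arbitrary; the library's \<^const>\<open>simplicial_complex\<close> is finite, so that ranks are finite.\<close>

definition planar_complex :: "'b::euclidean_space set set \<Rightarrow> ('b \<Rightarrow> real^2) \<Rightarrow> bool" where
  "planar_complex L h \<longleftrightarrow> simplicial_complex L \<and> continuous_on (\<Union>L) h \<and> inj_on h (\<Union>L)"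

text \<open>All later notions see the complex only through the family \<open>K\<close> of its
  (curved, closed) \<open>p\<close>-simplexes \<open>K p\<close>.\<close>

type_synonym plane_cells = "nat \<Rightarrow> (real^2) set set"

definition simplexes :: "'b::euclidean_space set set \<Rightarrow> ('b \<Rightarrow> real^2) \<Rightarrow> plane_cells" where
  "simplexes L h p = {h ` S | S. S \<in> L \<and> int p simplex S}"

definition polyhedron_of :: "plane_cells \<Rightarrow> (real^2) set" where
  "polyhedron_of K = (\<Union>p. \<Union>(K p))"

definition covers :: "plane_cells \<Rightarrow> (real^2) set \<Rightarrow> bool" where
  "covers K A \<longleftrightarrow> A \<subseteq> polyhedron_of K"


section \<open>Homology modulo 2\<close>

text \<open>A chain with coefficients modulo 2 is identified with the set of simplexes that have
  coefficient 1; addition is then symmetric difference.\<close>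

definition chain_group :: "plane_cells \<Rightarrow> nat \<Rightarrow> (real^2) set set monoid" where
  "chain_group K p = \<lparr>carrier = {c. c \<subseteq> K p \<and> finite c}, mult = sym_diff, one = {}\<rparr>"

text \<open>In a simplicial complex, the simplexes contained in a simplex are exactly its faces.
  The definition is meant for \<open>p > 0\<close>.\<close>

definition boundary :: "plane_cells \<Rightarrow> nat \<Rightarrow> (real^2) set set \<Rightarrow> (real^2) set set" where
  "boundary K p c = {t \<in> K (p - 1). odd (card {s \<in> c. t \<subseteq> s})}"

definition Z1 :: "plane_cells \<Rightarrow> (real^2) set set monoid" where
  "Z1 K = (chain_group K 1)
     \<lparr>carrier := kernel (chain_group K 1) (chain_group K 0) (boundary K 1)\<rparr>"

definition B1 :: "plane_cells \<Rightarrow> (real^2) set set monoid" where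
  "B1 K = (chain_group K 1)\<lparr>carrier := boundary K 2 ` carrier (chain_group K 2)\<rparr>"

definition H1 :: "plane_cells \<Rightarrow> (real^2) set set set monoid" where
  "H1 K = Z1 K Mod carrier (B1 K)"

text \<open>Least number of generators; for groups of exponent 2 this is the dimension over the field
  with two elements.\<close>

definition group_rank :: "('a, 'm) monoid_scheme \<Rightarrow> nat" where
  "group_rank G = (LEAST k. \<exists>S. S \<subseteq> carrier G \<and> finite S \<and> card S = k \<and> generate G S = carrier G)"


section \<open>1-cycles\<close>

definition hole :: "plane_cells \<Rightarrow> (real^2) set \<Rightarrow> bool" where
  "hole K U \<longleftrightarrow> U \<in> components (- polyhedron_of K) \<and> bounded U"

text \<open>A 1-cycle is recorded as the set of its arcs, which is at the same time a 1-chain.\<close>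

definition one_cycle :: "plane_cells \<Rightarrow> (real^2) set set \<Rightarrow> bool" where
  "one_cycle K C \<longleftrightarrow> C \<subseteq> K 1 \<and>
     (\<exists>c. simple_path c \<and> pathfinish c = pathstart c \<and> path_image c = \<Union>C) \<and>
     \<not> (\<exists>U. hole K U \<and> frontier U = \<Union>C)"

text \<open>The elements of the first homology group are cosets of chains.\<close>

definition cycles_H1 :: "plane_cells \<Rightarrow> (real^2) set set set" where
  "cycles_H1 K = {C. one_cycle K C \<and> (\<exists>X \<in> carrier (H1 K). C \<in> X)}"

definition arcs_H1 :: "plane_cells \<Rightarrow> (real^2) set set" where
  "arcs_H1 K = \<Union>(cycles_H1 K)"


section \<open>Descriptions and nearness\<close>

text \<open>A description sends arcs to vectors with \<open>n\<close> real coordinates, represented as lists so that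
  feature vectors of different lengths can be assembled into one.\<close>

type_synonym description = "(real^2) set \<Rightarrow> real list"

definition is_description :: "plane_cells \<Rightarrow> nat \<Rightarrow> description \<Rightarrow> bool" where
  "is_description K n \<Phi> \<longleftrightarrow> (\<forall>x \<in> K 1. length (\<Phi> x) = n)"

definition strongly_near :: "'a set \<Rightarrow> 'a set \<Rightarrow> bool" where
  "strongly_near S T \<longleftrightarrow> S \<inter> T \<noteq> {}"

definition desc_near :: "('a \<Rightarrow> 'f) \<Rightarrow> 'a set \<Rightarrow> 'a set \<Rightarrow> bool" where
  "desc_near \<Phi> S T \<longleftrightarrow> (\<exists>x \<in> S. \<exists>y \<in> T. \<Phi> x = \<Phi> y)"

definition desc_inter :: "('a \<Rightarrow> 'f) \<Rightarrow> 'a set \<Rightarrow> 'a set \<Rightarrow> 'a set" where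
  "desc_inter \<Phi> S T = {x \<in> S \<union> T. \<Phi> x \<in> \<Phi> ` S \<and> \<Phi> x \<in> \<Phi> ` T}"

definition desc_Inter :: "('a \<Rightarrow> 'f) \<Rightarrow> 'a set set \<Rightarrow> 'a set" where
  "desc_Inter \<Phi> N = {x \<in> \<Union>N. \<forall>S \<in> N. \<Phi> x \<in> \<Phi> ` S}"

lemma desc_Inter_pair: "desc_Inter \<Phi> {S, T} = desc_inter \<Phi> S T"
  by (auto simp: desc_Inter_def desc_inter_def)

definition homology_nerve :: "plane_cells \<Rightarrow> description \<Rightarrow> (real^2) set set set \<Rightarrow> bool" where
  "homology_nerve K \<Phi> N \<longleftrightarrow> N \<subseteq> cycles_H1 K \<and> desc_Inter \<Phi> N \<noteq> {}"

text \<open>The members of a nerve are always descriptively near each other; a nucleus is a member whose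
  whole cluster lies in the nerve, so that it represents the nerve.\<close>

definition nucleus ::
  "plane_cells \<Rightarrow> description \<Rightarrow> (real^2) set set set \<Rightarrow> (real^2) set set \<Rightarrow> bool" where
  "nucleus K \<Phi> N C \<longleftrightarrow> C \<in> N \<and> {B \<in> cycles_H1 K. desc_near \<Phi> C B} \<subseteq> N"


section \<open>Curvature\<close>

text \<open>\<open>x\<close> has curvature \<open>k\<close> at its point \<open>p\<close>, computed from some regular twice continuously
  differentiable parametrization of \<open>x\<close> (one-sided derivatives at the endpoints).\<close>

definition has_curvature :: "(real^2) set \<Rightarrow> real^2 \<Rightarrow> real \<Rightarrow> bool" where
  "has_curvature x p k \<longleftrightarrow> (\<exists>g g' g''. arc g \<and> path_image g = x \<and>
     (\<forall>t \<in> {0..1}. (g has_vector_derivative g' t) (at t within {0..1}) \<and>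
                  (g' has_vector_derivative g'' t) (at t within {0..1}) \<and> g' t \<noteq> 0) \<and>
     continuous_on {0..1} g'' \<and>
     (\<exists>t \<in> {0..1}. g t = p \<and>
        k = \<bar>g' t $ 1 * g'' t $ 2 - g' t $ 2 * g'' t $ 1\<bar> / norm (g' t) ^ 3))"

definition curvature_of :: "(real^2) set set \<Rightarrow> ((real^2) \<times> real) set" where
  "curvature_of C = {(p, k). \<exists>x \<in> C. has_curvature x p k}"

definition curvature_defined :: "(real^2) set set \<Rightarrow> bool" where
  "curvature_defined C \<longleftrightarrow> (\<forall>x \<in> C. \<forall>p \<in> x. \<exists>k. has_curvature x p k)"

text \<open>A feature of the curvature of a 1-cycle, such as its maximum.\<close>

type_synonym curvature_feature = "((real^2) \<times> real) set \<Rightarrow> real"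


section \<open>Closure finiteness and the weak topology\<close>

definition closure_finite_arc :: "plane_cells \<Rightarrow> (real^2) set \<Rightarrow> bool" where
  "closure_finite_arc K x \<longleftrightarrow>
     x \<in> arcs_H1 K \<and> finite {y \<in> arcs_H1 K. y \<noteq> x \<and> closure x \<inter> y \<noteq> {}}"

definition closure_finite :: "plane_cells \<Rightarrow> bool" where
  "closure_finite K \<longleftrightarrow> (\<forall>x \<in> arcs_H1 K. closure_finite_arc K x)"

definition closed_in_H1 :: "plane_cells \<Rightarrow> (real^2) set set \<Rightarrow> bool" where
  "closed_in_H1 K C \<longleftrightarrow> (\<forall>x \<in> arcs_H1 K. \<Union>C \<inter> x \<noteq> {} \<longrightarrow>
     closedin (top_of_set (\<Union>(arcs_H1 K))) (\<Union>C \<inter> x))"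


section \<open>Signatures\<close>

text \<open>The five kinds of components.  Each set consists of the real vectors that are admissible as a
  component of that kind; a finite set of cycles or arcs contributes through an enumeration.\<close>

definition geometry_components :: "plane_cells \<Rightarrow> curvature_feature set \<Rightarrow> real list set" where
  "geometry_components K F =
     {concat (map (\<lambda>C. map (\<lambda>f. f (curvature_of C)) fs) Cs) | fs Cs.
        fs \<noteq> [] \<and> set fs \<subseteq> F \<and>
        Cs \<noteq> [] \<and> distinct Cs \<and> set Cs = cycles_H1 K \<and> (\<forall>C \<in> cycles_H1 K. curvature_defined C)}"

definition homology_components :: "plane_cells \<Rightarrow> real list set" where
  "homology_components K = {[real r] | r. r = group_rank (H1 K) \<and>
     int r = int (group_rank (Z1 K)) - int (group_rank (B1 K))}"

definition nerve_components :: "plane_cells \<Rightarrow> description \<Rightarrow> real list set" where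
  "nerve_components K \<Phi> =
     {\<Phi> x | N C x. homology_nerve K \<Phi> N \<and> nucleus K \<Phi> N C \<and> x \<in> C \<and>
                    (\<forall>B \<in> N. \<exists>y \<in> B. \<Phi> y = \<Phi> x)}"

definition closure_finite_components :: "plane_cells \<Rightarrow> description \<Rightarrow> real list set" where
  "closure_finite_components K \<Phi> =
     {concat (map (\<lambda>(A, B, x). \<Phi> (closure x)) ts) | ts. ts \<noteq> [] \<and>
        (\<forall>(A, B, x) \<in> set ts. A \<in> cycles_H1 K \<and> B \<in> cycles_H1 K \<and> A \<noteq> B \<and>
           closure_finite_arc K x \<and> x \<in> desc_inter \<Phi> A B)} \<union>
     {concat (concat Ds) | Ds Cs. Cs \<noteq> [] \<and> distinct Cs \<and> set Cs \<subseteq> cycles_H1 K \<and>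
        (\<forall>C \<in> set Cs. \<forall>x \<in> C. closure_finite_arc K x) \<and>
        list_all2 (\<lambda>ds C. distinct ds \<and> set ds = \<Phi> ` C) Ds Cs}"

definition CW_components :: "plane_cells \<Rightarrow> description \<Rightarrow> real list set" where
  "CW_components K \<Phi> =
     {concat (map \<Phi> xs) | xs. xs \<noteq> [] \<and> distinct xs \<and>
        closure_finite K \<and> (\<forall>C \<in> cycles_H1 K. closed_in_H1 K C) \<and>
        set xs = {x. \<exists>A \<in> cycles_H1 K. \<exists>B \<in> cycles_H1 K. A \<noteq> B \<and> strongly_near A B \<and> x \<in> A \<inter> B}}"

definition homology_features ::
  "plane_cells \<Rightarrow> description \<Rightarrow> curvature_feature set \<Rightarrow> real list set" where
  "homology_features K \<Phi> F =
     geometry_components K F \<union> homology_components K \<union> nerve_components K \<Phi> \<union>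
     closure_finite_components K \<Phi> \<union> CW_components K \<Phi>"

text \<open>A feature vector is kept as the list of its components, each a real vector.\<close>

definition is_signature ::
  "(real^2) set \<Rightarrow> plane_cells \<Rightarrow> description \<Rightarrow> curvature_feature set \<Rightarrow> real list list \<Rightarrow> bool" where
  "is_signature A K \<Phi> F sig \<longleftrightarrow>
     planar_shape A \<and> covers K A \<and> (\<exists>b \<in> set sig. b \<in> homology_features K \<Phi> F)"

definition derived_from_homology ::
  "plane_cells \<Rightarrow> description \<Rightarrow> curvature_feature set \<Rightarrow> real list list \<Rightarrow> bool" where
  "derived_from_homology K \<Phi> F sig \<longleftrightarrow> set sig \<subseteq> homology_features K \<Phi> F"

end

theory Submission
  imports Defs
begin

text \<open>A finite group of exponent 2 and rank \<open>r\<close> has \<open>2 ^ r\<close> elements.  Since each vertex of a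
  triangle lies on exactly two of its edges, boundaries are cycles, and Lagrange's theorem for
  \<open>B\<^sub>1 \<le> Z\<^sub>1\<close> turns into \<open>rH\<^sub>1 = rZ\<^sub>1 - rB\<^sub>1\<close>.  Hence the Betti number alone is always
  an admissible signature.\<close>

section \<open>Groups of exponent 2 and their rank\<close>

lemma (in group) exponent_2_comm_group:
  assumes "\<And>x. x \<in> carrier G \<Longrightarrow> x \<otimes> x = \<one>"
  shows "comm_group G"
proof (rule group_comm_groupI)
  fix x y assume xy: "x \<in> carrier G" "y \<in> carrier G"
  have inv: "inv z = z" if "z \<in> carrier G" for z
    using assms that by (simp add: inv_equality)
  have "x \<otimes> y = inv (x \<otimes> y)"
    by (rule inv [symmetric]) (use xy in simp)
  also have "\<dots> = y \<otimes> x"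
    using inv_mult_group [OF xy] inv xy by metis
  finally show "x \<otimes> y = y \<otimes> x" .
qed

text \<open>Modulo \<open>H = generate G T\<close> the new element \<open>a\<close> still has order
  2, so adjoining it adds exactly one coset, disjoint from \<open>H\<close> and of the same
  size.\<close>

lemma (in group) card_generate_insert_exponent_2:
  assumes ex2: "\<And>x. x \<in> carrier G \<Longrightarrow> x \<otimes> x = \<one>"
    and fin: "finite (carrier G)"
    and T: "T \<subseteq> carrier G" and a: "a \<in> carrier G" "a \<notin> generate G T"
  shows "card (generate G (insert a T)) = 2 * card (generate G T)"
proof -
  interpret comm_group G
    using exponent_2_comm_group ex2 by blast
  define H where "H = generate G T"
  have H: "subgroup H G"
    unfolding H_def by (rule generate_is_subgroup [OF T])
  have Hc: "H \<subseteq> carrier G"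
    using H by (rule subgroup.subset)
  have inv: "inv z = z" if "z \<in> carrier G" for z
    using ex2 that by (simp add: inv_equality)
  define E where "E = H \<union> (\<otimes>) a ` H"
  \<comment> \<open>Since \<open>a\<close> is its own inverse, lying in the coset of
    \<open>a\<close> becomes a condition on membership in \<open>H\<close>; closure of
    \<open>E\<close> under products is then a case distinction.\<close>
  have E_eq: "x \<in> E \<longleftrightarrow> x \<in> H \<or> a \<otimes> x \<in> H" if x: "x \<in> carrier G" for x
  proof -
    have "x \<in> (\<otimes>) a ` H \<longleftrightarrow> a \<otimes> x \<in> H"
    proof
      assume "x \<in> (\<otimes>) a ` H"
      then obtain u where u: "u \<in> H" "x = a \<otimes> u" by blast
      then have "a \<otimes> x = u"
        using a Hc ex2 by (metis l_one m_assoc subsetD)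
      with u show "a \<otimes> x \<in> H" by simp
    next
      assume "a \<otimes> x \<in> H"
      moreover have "x = a \<otimes> (a \<otimes> x)"
        using a x ex2 by (metis l_one m_assoc)
      ultimately show "x \<in> (\<otimes>) a ` H" by blast
    qed
    then show ?thesis by (simp add: E_def)
  qed
  have Ec: "E \<subseteq> carrier G"
    using Hc a by (auto simp: E_def)
  have E: "subgroup E G"
  proof
    show "E \<subseteq> carrier G" by (rule Ec)
    show "\<one> \<in> E"
      using H by (simp add: E_def subgroup.one_closed)
    show "inv x \<in> E" if "x \<in> E" for x
      using that Ec inv by auto
    show "x \<otimes> y \<in> E" if "x \<in> E" "y \<in> E" for x y
    proof -
      have xy: "x \<in> carrier G" "y \<in> carrier G" using that Ec by auto
      have "a \<otimes> (x \<otimes> y) = (a \<otimes> x) \<otimes> y" "a \<otimes> (x \<otimes> y) = x \<otimes> (a \<otimes> y)"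
        using a xy by (simp_all add: m_ac)
      \<comment> \<open>This serves the case where both factors lie in the coset: the two copies of
        \<open>a\<close> cancel, and the product lands in \<open>H\<close>.\<close>
      moreover have "x \<otimes> y = (a \<otimes> x) \<otimes> (a \<otimes> y)"
      proof -
        have "(a \<otimes> x) \<otimes> (a \<otimes> y) = (a \<otimes> a) \<otimes> (x \<otimes> y)"
          using a xy by (simp add: m_ac)
        then show ?thesis using a xy ex2 by simp
      qed
      moreover have "x \<in> H \<or> a \<otimes> x \<in> H" "y \<in> H \<or> a \<otimes> y \<in> H"
        using that E_eq xy by auto
      ultimately show ?thesis
        using E_eq [of "x \<otimes> y"] xy H by (metis m_closed subgroup.m_closed)
    qed
  qed
  have "E = generate G (insert a T)"
  proof
    have "a \<in> E"
      using a ex2 H by (simp add: E_eq subgroup.one_closed)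
    moreover have "T \<subseteq> E"
      by (auto simp: E_def H_def generate.incl)
    ultimately show "generate G (insert a T) \<subseteq> E"
      using E by (intro generate_subgroup_incl) auto
    have "H \<subseteq> generate G (insert a T)"
      unfolding H_def by (rule mono_generate) auto
    moreover have "a \<in> generate G (insert a T)"
      by (simp add: generate.incl)
    ultimately show "E \<subseteq> generate G (insert a T)"
      by (auto simp: E_def intro: generate.eng)
  qed
  moreover have "card E = 2 * card H"
  proof -
    have "H \<inter> (\<otimes>) a ` H = {}"
    proof (rule ccontr)
      assume "H \<inter> (\<otimes>) a ` H \<noteq> {}"
      then obtain u where u: "u \<in> H" "a \<otimes> u \<in> H" by blast
      have uc: "u \<in> carrier G" using u Hc by auto
      have "a = (a \<otimes> u) \<otimes> u"
        using uc a ex2 by (simp add: m_assoc)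
      then have "a \<in> H"
        using u H by (metis subgroup.m_closed)
      with a show False by (simp add: H_def)
    qed
    moreover have "card ((\<otimes>) a ` H) = card H"
      using a Hc by (intro card_image inj_onI) (metis Units_eq Units_l_cancel subsetD)
    moreover have "finite H"
      using Hc fin by (rule finite_subset)
    ultimately show ?thesis
      by (simp add: E_def card_Un_disjoint)
  qed
  ultimately show ?thesis
    by (simp add: H_def)
qed

text \<open>A generating set of least size is independent, so adjoining its elements one at a time
  doubles the generated subgroup at every step, starting from the trivial group.\<close>

lemma (in group) card_eq_power_group_rank:
  assumes ex2: "\<And>x. x \<in> carrier G \<Longrightarrow> x \<otimes> x = \<one>"
    and fin: "finite (carrier G)"
  shows "card (carrier G) = 2 ^ group_rank G"
proof -
  let ?P = "\<lambda>k. \<exists>S. S \<subseteq> carrier G \<and> finite S \<and> card S = k \<and> generate G S = carrier G"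
  have "generate G (carrier G) = carrier G"
    using generate_incl [of "carrier G"] by (auto intro: generate.incl)
  \<comment> \<open>The whole carrier generates, so \<open>LEAST\<close> in
    \<open>group_rank\<close> ranges over a nonempty set of sizes and its value is attained.\<close>
  then have "?P (card (carrier G))"
    using fin by blast
  then have "?P (group_rank G)"
    unfolding group_rank_def by (rule LeastI)
  then obtain S where S: "S \<subseteq> carrier G" "finite S" "card S = group_rank G"
      "generate G S = carrier G"
    by blast
  have least: "group_rank G \<le> k" if "?P k" for k
    unfolding group_rank_def using that by (rule Least_le)
  have "card (generate G T) = 2 ^ card T" if "T \<subseteq> S" for T
    using finite_subset [OF that \<open>finite S\<close>] that
  proof (induction T rule: finite_induct)
    case empty
    then show ?case by (simp add: generate_empty)
  next
    case (insert a T)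
    \<comment> \<open>Otherwise \<open>a\<close> would be generated by the rest of \<open>S\<close>,
      and \<open>S - {a}\<close> would be a strictly smaller generating set.\<close>
    have "a \<notin> generate G T"
    proof
      assume "a \<in> generate G T"
      moreover have "generate G T \<subseteq> generate G (S - {a})"
        using insert by (intro mono_generate) auto
      moreover have "S - {a} \<subseteq> generate G (S - {a})"
        by (auto intro: generate.incl)
      ultimately have "S \<subseteq> generate G (S - {a})"
        by blast
      moreover have "subgroup (generate G (S - {a})) G"
        using S by (intro generate_is_subgroup) auto
      ultimately have "generate G S \<subseteq> generate G (S - {a})"
        by (rule generate_subgroup_incl)
      then have "generate G (S - {a}) = carrier G"
        using S generate_incl [of "S - {a}"] by auto
      then have "?P (card (S - {a}))"
        using S by (intro exI [of _ "S - {a}"]) auto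
      then have "group_rank G \<le> card (S - {a})"
        by (rule least)
      moreover have "card (S - {a}) < card S"
        using insert.prems S by (intro card_Diff1_less) auto
      ultimately show False using S by simp
    qed
    then show ?case
      using insert S card_generate_insert_exponent_2 [OF ex2 fin, of T a] by auto
  qed
  from this [of S] show ?thesis
    using S by simp
qed

text \<open>The subgroup and the quotient inherit exponent 2, so all three orders are powers of 2
  and Lagrange's theorem can be read off in the exponents.\<close>

lemma (in group) group_rank_Mod_exponent_2:
  assumes ex2: "\<And>x. x \<in> carrier G \<Longrightarrow> x \<otimes> x = \<one>"
    and fin: "finite (carrier G)" and H: "subgroup H G"
  shows "group_rank (G Mod H) + group_rank (G\<lparr>carrier := H\<rparr>) = group_rank G"
proof -
  interpret comm_group G
    using exponent_2_comm_group ex2 by blast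
  interpret H: normal H G
    using H by (rule subgroup_imp_normal)
  have "card (carrier (G Mod H)) = 2 ^ group_rank (G Mod H)"
  proof (rule group.card_eq_power_group_rank)
    show "group (G Mod H)" by (rule H.factorgroup_is_group)
    \<comment> \<open>The square of the coset of \<open>x\<close> is the coset of the square of
      \<open>x\<close>, that is, \<open>H\<close> itself.\<close>
    show "X \<otimes>\<^bsub>G Mod H\<^esub> X = \<one>\<^bsub>G Mod H\<^esub>" if "X \<in> carrier (G Mod H)" for X
      using that ex2 H.rcos_sum H.subset
      by (auto simp: FactGroup_def RCOSETS_def coset_mult_one)
    show "finite (carrier (G Mod H))"
      using fin by (simp add: FactGroup_def RCOSETS_def)
  qed
  moreover have "card H = 2 ^ group_rank (G\<lparr>carrier := H\<rparr>)"
    using group.card_eq_power_group_rank [OF H.subgroup_is_group [OF is_group]]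
      ex2 fin finite_subset [OF H.subset] H.subset by auto
  moreover have "card (carrier (G Mod H)) * card H = card (carrier G)"
    using lagrange [OF H] by (simp add: FactGroup_def order_def)
  ultimately have "(2::nat) ^ (group_rank (G Mod H) + group_rank (G\<lparr>carrier := H\<rparr>)) = 2 ^ group_rank G"
    using card_eq_power_group_rank [OF ex2 fin] by (simp add: power_add)
  then show ?thesis by simp
qed

section \<open>Chain groups and additivity of the boundary\<close>

lemma group_chain_group: "group (chain_group K p)"
proof (rule groupI)
  fix x assume "x \<in> carrier (chain_group K p)"
  then show "\<exists>y \<in> carrier (chain_group K p).
      y \<otimes>\<^bsub>chain_group K p\<^esub> x = \<one>\<^bsub>chain_group K p\<^esub>"
    \<comment> \<open>A chain modulo 2 is its own inverse.\<close>
    by (intro bexI [of _ x]) (auto simp: chain_group_def)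
qed (auto simp: chain_group_def)

lemma odd_card_sym_diff:
  assumes "finite A" "finite B"
  shows "odd (card (sym_diff A B)) \<longleftrightarrow> odd (card A) \<noteq> odd (card B)"
proof -
  have "card A = card (A - B) + card (A \<inter> B)" "card B = card (B - A) + card (A \<inter> B)"
    using assms by (metis Int_commute add.commute card_Int_Diff)+
  moreover have "card (sym_diff A B) = card (A - B) + card (B - A)"
    using assms by (intro card_Un_disjoint) auto
  ultimately show ?thesis by (metis even_add)
qed

text \<open>The coefficient of \<open>t\<close> in a boundary is a parity of incident simplexes, and
  parities add under symmetric difference. Finiteness of \<open>K (p - 1)\<close> makes the boundary
  a finite set, as membership in the chain group demands.\<close>

lemma boundary_hom:
  assumes "finite (K (p - 1))"
  shows "boundary K p \<in> hom (chain_group K p) (chain_group K (p - 1))"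
proof (rule homI)
  fix c assume "c \<in> carrier (chain_group K p)"
  show "boundary K p c \<in> carrier (chain_group K (p - 1))"
    using assms by (auto simp: chain_group_def boundary_def)
next
  fix c d assume "c \<in> carrier (chain_group K p)" "d \<in> carrier (chain_group K p)"
  then have fin: "finite c" "finite d"
    by (auto simp: chain_group_def)
  have "odd (card {s \<in> sym_diff c d. t \<subseteq> s}) \<longleftrightarrow>
      odd (card {s \<in> c. t \<subseteq> s}) \<noteq> odd (card {s \<in> d. t \<subseteq> s})" for t
  proof -
    have "{s \<in> sym_diff c d. t \<subseteq> s} = sym_diff {s \<in> c. t \<subseteq> s} {s \<in> d. t \<subseteq> s}"
      by auto
    then show ?thesis
      using fin by (simp add: odd_card_sym_diff)
  qed
  then show "boundary K p (c \<otimes>\<^bsub>chain_group K p\<^esub> d) =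
      boundary K p c \<otimes>\<^bsub>chain_group K (p - 1)\<^esub> boundary K p d"
    unfolding boundary_def chain_group_def by auto
qed

section \<open>Incidence of vertices, edges and triangles; the boundary of a boundary\<close>

text \<open>Faces of a triangle correspond to subsets of its three vertices, so an edge through
  \<open>x\<close> is determined by its other end, for which two vertices remain.\<close>

lemma card_edges_at_vertex:
  assumes L: "simplicial_complex L" and S: "S \<in> L" "2 simplex S"
    and x: "{x} \<in> L" "x \<in> S"
  shows "card {E \<in> L. 1 simplex E \<and> x \<in> E \<and> E \<subseteq> S} = 2"
proof -
  obtain V where V: "finite V" "\<not> affine_dependent V" "int (card V) = 3" "S = convex hull V"
    using S(2) by (auto simp: simplex)
  \<comment> \<open>Affine independence: no vertex lies in the affine hull of the others. Hence a
    hull of vertices determines which vertices span it.\<close>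
  have in_hull: "v \<in> convex hull c \<longleftrightarrow> v \<in> c" if "c \<subseteq> V" "v \<in> V" for v c
  proof
    assume v: "v \<in> convex hull c"
    show "v \<in> c"
    proof (rule ccontr)
      assume "v \<notin> c"
      then have "c \<subseteq> V - {v}" using that by auto
      then have "convex hull c \<subseteq> affine hull (V - {v})"
        using convex_hull_subset_affine_hull hull_mono by (metis subset_trans)
      then show False
        using v V(2) that by (auto simp: affine_dependent_def)
    qed
  qed (rule hull_inc)
  have face: "T face_of S" if "T \<in> L" "T \<subseteq> S" for T
    using L S(1) that unfolding simplicial_complex_def by (metis Int_absorb1)
  \<comment> \<open>From left to right, simplexes of a complex meet in common faces, so a simplex
    inside \<open>S\<close> is a face of it; from right to left, a complex contains all faces of its
    simplexes.\<close>
  have faces: "T \<in> L \<and> T \<subseteq> S \<longleftrightarrow> (\<exists>c\<subseteq>V. T = convex hull c)" for T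
  proof
    assume "T \<in> L \<and> T \<subseteq> S"
    then show "\<exists>c\<subseteq>V. T = convex hull c"
      using face face_of_convex_hull_affine_independent [OF V(2)] V(4) by auto
  next
    assume "\<exists>c\<subseteq>V. T = convex hull c"
    then have "T face_of S"
      using face_of_convex_hull_affine_independent [OF V(2)] V(4) by auto
    then show "T \<in> L \<and> T \<subseteq> S"
      using L S(1) face_of_imp_subset unfolding simplicial_complex_def by blast
  qed
  have xV: "x \<in> V"
  proof -
    have "{x} \<in> L \<and> {x} \<subseteq> S" using x by simp
    then obtain c where c: "c \<subseteq> V" "{x} = convex hull c"
      using faces by blast
    then have "c \<noteq> {}" "c \<subseteq> {x}"
      using hull_subset [of c convex] by auto
    with c show ?thesis by auto
  qed
  have "{E \<in> L. 1 simplex E \<and> x \<in> E \<and> E \<subseteq> S} = (\<lambda>y. convex hull {x, y}) ` (V - {x})"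
  proof (intro Set.set_eqI iffI)
    fix E assume E: "E \<in> {E \<in> L. 1 simplex E \<and> x \<in> E \<and> E \<subseteq> S}"
    then obtain c where c: "c \<subseteq> V" "E = convex hull c"
      using faces [of E] by auto
    have "\<not> affine_dependent c"
      using affine_dependent_subset V(2) c(1) by blast
    \<comment> \<open>Dimension counts the spanning vertices: dimension 1 leaves exactly two, one of
      them \<open>x\<close>.\<close>
    then have "aff_dim E = int (card c) - 1"
      by (simp add: c aff_dim_convex_hull aff_dim_affine_independent)
    moreover have "aff_dim E = 1"
      using E aff_dim_simplex by blast
    ultimately have "card c = 2" by simp
    moreover have "x \<in> c"
      using E in_hull c xV by auto
    ultimately obtain y where "c = {x, y}" "x \<noteq> y"
      by (auto simp: card_2_iff)
    then show "E \<in> (\<lambda>y. convex hull {x, y}) ` (V - {x})"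
      using c by auto
  next
    fix E assume "E \<in> (\<lambda>y. convex hull {x, y}) ` (V - {x})"
    then obtain y where y: "y \<in> V" "x \<noteq> y" "E = convex hull {x, y}" by auto
    then have "1 simplex E"
      using one_simplex_segment by (simp add: segment_convex_hull)
    moreover have "x \<in> E"
      by (simp add: y(3) hull_inc)
    moreover have "E \<in> L \<and> E \<subseteq> S"
      using y xV unfolding faces by (intro exI [of _ "{x, y}"]) auto
    ultimately show "E \<in> {E \<in> L. 1 simplex E \<and> x \<in> E \<and> E \<subseteq> S}"
      by simp
  qed
  moreover have "inj_on (\<lambda>y. convex hull {x, y}) (V - {x})"
  proof (rule inj_onI)
    fix y z assume yz: "y \<in> V - {x}" "z \<in> V - {x}" "convex hull {x, y} = convex hull {x, z}"
    then have "z \<in> convex hull {x, y}"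
      by (simp add: hull_inc)
    then show "y = z"
      using in_hull [of "{x, y}" z] yz xV by auto
  qed
  ultimately show ?thesis
    using V xV by (simp add: card_image)
qed

text \<open>Injectivity of \<open>h\<close> on the polyhedron preserves and reflects inclusion
  between simplexes, so the count for the straight complex carries over to the curved one.\<close>

lemma card_curved_edges_at_vertex:
  assumes L: "planar_complex L h"
    and s: "s \<in> simplexes L h 2" and t: "t \<in> simplexes L h 0" "t \<subseteq> s"
  shows "card {e \<in> simplexes L h 1. t \<subseteq> e \<and> e \<subseteq> s} = 2"
proof -
  have sc: "simplicial_complex L" and inj: "inj_on h (\<Union>L)"
    using L by (auto simp: planar_complex_def)
  have sub: "h ` P \<subseteq> h ` Q \<longleftrightarrow> P \<subseteq> Q" if "P \<in> L" "Q \<in> L" for P Q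
    using inj_on_image_subset_iff [OF inj] that by blast
  obtain S where S: "S \<in> L" "2 simplex S" "s = h ` S"
    using s by (auto simp: simplexes_def)
  obtain x where x: "{x} \<in> L" "t = h ` {x}"
    using t(1) by (auto simp: simplexes_def simplex_zero)
  have "{x} \<subseteq> S"
    using sub [of "{x}" S] x S t(2) by blast
  have "{e \<in> simplexes L h 1. t \<subseteq> e \<and> e \<subseteq> s} = (`) h ` {E \<in> L. 1 simplex E \<and> x \<in> E \<and> E \<subseteq> S}"
    (is "?l = _ ` ?r")
  proof (intro Set.set_eqI iffI)
    fix e assume "e \<in> ?l"
    then obtain E where E: "E \<in> L" "1 simplex E" "e = h ` E" "h ` {x} \<subseteq> h ` E" "h ` E \<subseteq> h ` S"
      using x S by (auto simp: simplexes_def)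
    then have "{x} \<subseteq> E" "E \<subseteq> S"
      using sub x S by blast+
    with E show "e \<in> (`) h ` ?r" by blast
  next
    fix e assume "e \<in> (`) h ` ?r"
    then show "e \<in> ?l"
      using x S by (auto simp: simplexes_def)
  qed
  moreover have "inj_on ((`) h) ?r"
    using inj sub by (intro inj_onI) blast
  ultimately show ?thesis
    using card_edges_at_vertex [OF sc S(1,2) x(1)] \<open>{x} \<subseteq> S\<close> by (simp add: card_image)
qed

lemma finite_simplexes:
  assumes "planar_complex L h"
  shows "finite (simplexes L h p)"
proof (rule finite_subset)
  show "simplexes L h p \<subseteq> (`) h ` L"
    by (auto simp: simplexes_def)
  show "finite ((`) h ` L)"
    using assms by (auto simp: planar_complex_def simplicial_complex_def)
qed

text \<open>Fix a vertex \<open>t\<close> and count the pairs of an edge through \<open>t\<close>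
  and a triangle of \<open>c\<close> containing that edge. Counted by triangles the total is even,
  which forces evenly many edges of the boundary to pass through \<open>t\<close>.\<close>

lemma boundary_boundary:
  assumes L: "planar_complex L h" and c: "c \<subseteq> simplexes L h 2"
  shows "boundary (simplexes L h) 1 (boundary (simplexes L h) 2 c) = {}"
proof -
  let ?K = "simplexes L h"
  have fc: "finite c"
    using c finite_simplexes [OF L] finite_subset by blast
  have "even (card {e \<in> boundary ?K 2 c. t \<subseteq> e})" if t: "t \<in> ?K 0" for t
  proof -
    define E where "E = {e \<in> ?K 1. t \<subseteq> e}"
    have fE: "finite E"
      using finite_simplexes [OF L] by (simp add: E_def)
    have "(\<Sum>e\<in>E. card {s \<in> c. e \<subseteq> s}) = (\<Sum>s\<in>c. card {e \<in> E. e \<subseteq> s})"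
      using fc fE by (intro sum_multicount_gen) auto
    \<comment> \<open>A triangle contributes two edges if \<open>t\<close> is one of its vertices;
      if \<open>t\<close> is outside it, no edge through \<open>t\<close> fits inside.\<close>
    moreover have "even (\<Sum>s\<in>c. card {e \<in> E. e \<subseteq> s})"
    proof (rule dvd_sum)
      fix s assume s: "s \<in> c"
      have "{e \<in> E. e \<subseteq> s} = {e \<in> ?K 1. t \<subseteq> e \<and> e \<subseteq> s}"
        by (auto simp: E_def)
      moreover have "even (card {e \<in> ?K 1. t \<subseteq> e \<and> e \<subseteq> s})"
      proof (cases "t \<subseteq> s")
        case True
        have "s \<in> ?K 2" using s c by blast
        then show ?thesis
          using card_curved_edges_at_vertex [OF L _ t True] by simp
      next
        case False
        then have "{e \<in> ?K 1. t \<subseteq> e \<and> e \<subseteq> s} = {}"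
          by blast
        then show ?thesis by (simp only: card.empty even_zero)
      qed
      ultimately show "even (card {e \<in> E. e \<subseteq> s})"
        by (simp only:)
    qed
    \<comment> \<open>A sum is even iff evenly many summands are odd, and the edges with odd summand
      are those that \<open>boundary\<close> keeps.\<close>
    ultimately have "even (card {e \<in> E. odd (card {s \<in> c. e \<subseteq> s})})"
      using even_sum_iff [OF fE, of "\<lambda>e. card {s \<in> c. e \<subseteq> s}"] by simp
    moreover have "{e \<in> E. odd (card {s \<in> c. e \<subseteq> s})} = {e \<in> boundary ?K 2 c. t \<subseteq> e}"
      by (auto simp: E_def boundary_def)
    ultimately show ?thesis by simp
  qed
  then show ?thesis
    unfolding boundary_def [of ?K 1] by auto
qed

section \<open>The Betti number and the signature\<close>

text \<open>Boundaries form a subgroup of the finite group of cycles, so the rank formula for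
  quotients applies. The additive form avoids truncated subtraction on naturals.\<close>

lemma group_rank_H1:
  assumes L: "planar_complex L h"
  defines "K \<equiv> simplexes L h"
  shows "group_rank (H1 K) + group_rank (B1 K) = group_rank (Z1 K)"
proof -
  interpret d1: group_hom "chain_group K 1" "chain_group K 0" "boundary K 1"
    using boundary_hom [of K 1] finite_simplexes [OF L] group_chain_group
    by (auto simp: group_hom_def group_hom_axioms_def K_def)
  interpret d2: group_hom "chain_group K 2" "chain_group K 1" "boundary K 2"
    using boundary_hom [of K 2] finite_simplexes [OF L] group_chain_group
    by (auto simp: group_hom_def group_hom_axioms_def K_def)
  have Z: "group (Z1 K)"
    unfolding Z1_def using d1.subgroup_kernel by (rule d1.G.subgroup_imp_group)
  have "boundary K 2 ` carrier (chain_group K 2) \<subseteq>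
      kernel (chain_group K 1) (chain_group K 0) (boundary K 1)"
    using boundary_boundary [OF L] d2.hom_closed
    by (auto simp: kernel_def) (auto simp: K_def chain_group_def)
  then have "subgroup (carrier (B1 K)) (Z1 K)"
    using d1.G.subgroup_incl [OF d2.img_is_subgroup d1.subgroup_kernel]
    by (simp add: B1_def Z1_def)
  moreover have "x \<otimes>\<^bsub>Z1 K\<^esub> x = \<one>\<^bsub>Z1 K\<^esub>" for x
    by (simp add: Z1_def chain_group_def)
  moreover have "finite (carrier (Z1 K))"
    using finite_simplexes [OF L, of 1]
    by (auto simp: Z1_def kernel_def chain_group_def K_def)
  ultimately have "group_rank (Z1 K Mod carrier (B1 K)) +
      group_rank (Z1 K\<lparr>carrier := carrier (B1 K)\<rparr>) = group_rank (Z1 K)"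
    using group.group_rank_Mod_exponent_2 [OF Z] by blast
  \<comment> \<open>Both records are \<open>chain_group K 1\<close> with the carrier replaced, so
    overwriting the carrier of one gives the other.\<close>
  moreover have "Z1 K\<lparr>carrier := carrier (B1 K)\<rparr> = B1 K"
    by (simp add: Z1_def B1_def)
  ultimately show ?thesis
    by (simp add: H1_def)
qed

theorem theorem7:
  fixes A :: "(real^2) set"
    and L :: "'b::euclidean_space set set" and h :: "'b \<Rightarrow> real^2"
    and \<Phi> :: "(real^2) set \<Rightarrow> real list" and n :: nat
    and F :: "(((real^2) \<times> real) set \<Rightarrow> real) set"
  assumes "planar_shape A"
    and "planar_complex L h"
    and "covers (simplexes L h) A"
    and "0 < n" and "is_description (simplexes L h) n \<Phi>"
  shows "\<exists>sig. is_signature A (simplexes L h) \<Phi> F sig \<and>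
               derived_from_homology (simplexes L h) \<Phi> F sig"
proof -
  let ?K = "simplexes L h"
  \<comment> \<open>The additive rank identity supplies the integer difference required by
    \<open>homology_components\<close>.\<close>
  have "[real (group_rank (H1 ?K))] \<in> homology_features ?K \<Phi> F"
    using group_rank_H1 [OF \<open>planar_complex L h\<close>]
    by (auto simp: homology_features_def homology_components_def)
  then show ?thesis
    \<comment> \<open>The feature vector consists of one component, itself a real vector of length
      1, hence the nested list.\<close>
    using assms by (intro exI [of _ "[[real (group_rank (H1 ?K))]]"])
      (auto simp: is_signature_def derived_from_homology_def)
qed

end
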